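(* Let $K$ be the Strichartz hexacarpet with the metrics $d_\mu$, $\mu\in[1/2,1)$. For all $\mu\in[1/2,1)$, $d_\mu$ does not satisfy the chain condition, and for all $\theta\in(0,-\log\mu/\log 2)$, $d_\mu$ does satisfy the $\theta$-chain condition.
   Context: Let $W=\{0,1,2,3,4,5\}$, $W_0=\{\emptyset\}$, $W_n=W^n$ the set of words $w=w_1\ldots w_n$ of length $n$ ($n\ge1$), $W_*=\bigcup_{n\ge0}W_n$, and $|w|=n$ for $w\in W_n$ (with $|\emptyset|=0$). Let $W_\infty$ be the set of infinite words over $W$ with the product topology. Concatenation is written by juxtaposition; $\{0,5\}^\infty\subseteq W_\infty$ is the set of infinite words with all letters in $\{0,5\}$. Let $\sim$ be the equivalence relation on $W_\infty$ whose only non-trivial identifications are the following: for all $w\in W_*$, $i\in W$, $j=i+1\ (\mathrm{mod}\ 6)$, $v\in\{0,5\}^\infty$: if $i$ is even, $wi1v\sim wj1v$ and $wi2v\sim wj2v$; if $i$ is odd, $wi3v\sim wj3v$ and $wi4v\sim wj4v$. The Strichartz hexacarpet is $K=W_\infty/\!\sim$ with the quotient topology, $\pi:W_\infty\to K$ the quotient map. For $i\in W$, $f_i:K\to K$ is the unique map with $\pi(iw)=f_i(\pi(w))$ for all $w\in W_\infty$. For $w=w_1\ldots w_n\in W_*$, $f_w=f_{w_1}\circ\cdots\circ f_{w_n}$ ($f_\emptyset=\mathrm{id}$) and $K_w=f_w(K)$. For $\mu\in(0,1)$ and $w\in W_*$ let $g_\mu(w)=\mu^{|w|}$. A chain is a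 finite sequence $\{w^{(1)},\ldots,w^{(m)}\}$ ($m\ge1$) of elements of $W_*$ with $K_{w^{(i)}}\cap K_{w^{(i+1)}}\ne\emptyset$ for $i=1,\ldots,m-1$. For $x,y\in K$, $\mathcal{C}(x,y)$ is the set of chains with $x\in K_{w^{(1)}}$ and $y\in K_{w^{(m)}}$, and $$d_\mu(x,y)=\inf\Big\{\sum_{i=1}^m g_\mu(w^{(i)}):\{w^{(1)},\ldots,w^{(m)}\}\in\mathcal{C}(x,y)\Big\},$$ which is a pseudo-metric on $K$ (and a metric when $\mu\in[1/2,1)$). A metric space $(K,d)$ satisfies the chain condition (respectively, the $\theta$-chain condition) if there exists a positive constant $C$ such that for all $x,y\in K$ and all $n\ge1$ there exists a sequence $\{x_0,x_1,\ldots,x_n\}$ in $K$ with $x_0=x$, $x_n=y$ and $$d(x_i,x_{i+1})\le C\frac{d(x,y)}{n}\quad\Big(\text{respectively, } d(x_i,x_{i+1})\le C\frac{d(x,y)}{n^\theta}\Big)\quad\text{for all } i=0,\ldots,n-1.$$ *)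

theory Defs
  imports Complex_Main "HOL-Library.Stream" "HOL-Library.Numeral_Type"
begin

text \<open>
  The alphabet is the six-element type 6, whose addition is arithmetic modulo 6, so that
  the successor of the letter 5 is the letter 0. Finite words are lists and infinite words are
  streams over it.
\<close>

type_synonym letter = 6

lemma UNIV_letter: "(UNIV :: letter set) = {0, 1, 2, 3, 4, 5}"
proof -
  have "card {0, 1, 2, 3, 4, 5 :: letter} = CARD(letter)"
    by simp
  then show ?thesis
    by (metis card_subset_eq finite subset_UNIV)
qed

inductive hex_ident :: "letter stream \<Rightarrow> letter stream \<Rightarrow> bool" where
  even: "\<lbrakk>i \<in> {0, 2, 4}; c \<in> {1, 2}; sset v \<subseteq> {0, 5}\<rbrakk>
    \<Longrightarrow> hex_ident (w @- i ## c ## v) (w @- (i + 1) ## c ## v)"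
| odd: "\<lbrakk>i \<in> {1, 3, 5}; c \<in> {3, 4}; sset v \<subseteq> {0, 5}\<rbrakk>
    \<Longrightarrow> hex_ident (w @- i ## c ## v) (w @- (i + 1) ## c ## v)"

text \<open>
  The generating identifications, made reflexive and symmetric, already form an equivalence
  relation (lemma \<open>equivp_hex_sim\<close>), so nothing else is identified.
\<close>

definition hex_sim :: "letter stream \<Rightarrow> letter stream \<Rightarrow> bool" where
  "hex_sim x y \<longleftrightarrow> x = y \<or> hex_ident x y \<or> hex_ident y x"

lemma hex_ident_Cons: "hex_ident x y \<Longrightarrow> hex_ident (a ## x) (a ## y)"
proof (induction rule: hex_ident.induct)
  case (even i c v w)
  then show ?case using hex_ident.even[of i c v "a # w"] by simp
next
  case (odd i c v w)
  then show ?case using hex_ident.odd[of i c v "a # w"] by simp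
qed

lemma hex_sim_Cons: "hex_sim x y \<Longrightarrow> hex_sim (a ## x) (a ## y)"
  by (auto simp: hex_sim_def intro: hex_ident_Cons)

lemma hex_decomposition_unique:
  assumes "w @- i ## c ## v = w' @- i' ## c' ## v'"
    and "c \<notin> {0, 5}" "c' \<notin> {0, 5 :: letter}" "sset v \<subseteq> {0, 5}" "sset v' \<subseteq> {0, 5}"
  shows "w = w' \<and> i = i' \<and> c = c' \<and> v = v'"
  using assms(1)
proof (induction w arbitrary: w')
  case Nil
  show ?case
  proof (cases w')
    case Nil
    then show ?thesis using Nil.prems by simp
  next
    case (Cons b u)
    then have "c ## v = u @- i' ## c' ## v'" using Nil.prems by simp
    then have "c' \<in> sset v"
      by (cases u) auto
    then show ?thesis using assms by blast
  qed
next
  case (Cons a w)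
  show ?case
  proof (cases w')
    case Nil
    then have "w @- i ## c ## v = c' ## v'" using Cons.prems by simp
    then have "c \<in> sset v'"
      by (cases w) auto
    then show ?thesis using assms by blast
  next
    case (Cons b u)
    then show ?thesis using Cons.IH[of u] Cons.prems by simp
  qed
qed

lemma hex_ident_cases:
  assumes "hex_ident x y"
  obtains w i c v where "x = w @- i ## c ## v" "y = w @- (i + 1) ## c ## v"
    "i \<in> {0, 2, 4} \<and> c \<in> {1, 2} \<or> i \<in> {1, 3, 5} \<and> c \<in> {3, 4}"
    "c \<notin> {0, 5}" "sset v \<subseteq> {0, 5}"
  using assms
proof (cases rule: hex_ident.cases)
  case (even i c v w)
  have "c \<notin> {0, 5}" using even(4) by auto
  then show ?thesis using that[of w i c v] even by blast
next
  case (odd i c v w)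
  have "c \<notin> {0, 5}" using odd(4) by auto
  then show ?thesis using that[of w i c v] odd by blast
qed

lemma hex_ident_right_unique:
  assumes "hex_ident x y" "hex_ident x z"
  shows "y = z"
proof -
  obtain w i c v where 1: "x = w @- i ## c ## v" "y = w @- (i + 1) ## c ## v"
      "c \<notin> {0, 5}" "sset v \<subseteq> {0, 5}"
    using assms(1) by (rule hex_ident_cases)
  obtain w' i' c' v' where 2: "x = w' @- i' ## c' ## v'" "z = w' @- (i' + 1) ## c' ## v'"
      "c' \<notin> {0, 5}" "sset v' \<subseteq> {0, 5}"
    using assms(2) by (rule hex_ident_cases)
  have "w @- i ## c ## v = w' @- i' ## c' ## v'"
    using 1(1) 2(1) by simp
  from hex_decomposition_unique[OF this 1(3) 2(3) 1(4) 2(4)] show ?thesis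
    using 1(1,2) 2(1,2) by simp
qed

lemma hex_ident_left_unique:
  assumes "hex_ident x y" "hex_ident z y"
  shows "x = z"
proof -
  obtain w i c v where 1: "x = w @- i ## c ## v" "y = w @- (i + 1) ## c ## v"
      "c \<notin> {0, 5}" "sset v \<subseteq> {0, 5}"
    using assms(1) by (rule hex_ident_cases)
  obtain w' i' c' v' where 2: "z = w' @- i' ## c' ## v'" "y = w' @- (i' + 1) ## c' ## v'"
      "c' \<notin> {0, 5}" "sset v' \<subseteq> {0, 5}"
    using assms(2) by (rule hex_ident_cases)
  have "w @- (i + 1) ## c ## v = w' @- (i' + 1) ## c' ## v'"
    using 1(2) 2(2) by simp
  from hex_decomposition_unique[OF this 1(3) 2(3) 1(4) 2(4)] show ?thesis
    using 1(1,2) 2(1,2) by simp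
qed

lemma hex_ident_no_two_steps:
  assumes "hex_ident x y" "hex_ident y z"
  shows False
proof -
  obtain w i c v where 1: "y = w @- (i + 1) ## c ## v"
      "i \<in> {0, 2, 4} \<and> c \<in> {1, 2} \<or> i \<in> {1, 3, 5} \<and> c \<in> {3, 4}"
      "c \<notin> {0, 5}" "sset v \<subseteq> {0, 5}"
    using assms(1) by (rule hex_ident_cases)
  obtain w' i' c' v' where 2: "y = w' @- i' ## c' ## v'"
      "i' \<in> {0, 2, 4} \<and> c' \<in> {1, 2} \<or> i' \<in> {1, 3, 5} \<and> c' \<in> {3, 4}"
      "c' \<notin> {0, 5}" "sset v' \<subseteq> {0, 5}"
    using assms(2) by (rule hex_ident_cases)
  have "w @- (i + 1) ## c ## v = w' @- i' ## c' ## v'" using 1(1) 2(1) by simp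
  from hex_decomposition_unique[OF this 1(3) 2(3) 1(4) 2(4)]
  have eq: "i' = i + 1" "c' = c" by simp_all
  have "c \<in> {1, 2} \<Longrightarrow> c \<notin> {3, 4}" "i \<in> {0, 2, 4} \<Longrightarrow> i + 1 \<notin> {0, 2, 4}"
      "i \<in> {1, 3, 5} \<Longrightarrow> i + 1 \<notin> {1, 3, 5}"
    by auto
  with 1(2) 2(2) show False unfolding eq by blast
qed

lemma equivp_hex_sim: "equivp hex_sim"
proof (rule equivpI)
  show "reflp hex_sim" by (simp add: reflp_def hex_sim_def)
  show "symp hex_sim" by (auto simp: symp_def hex_sim_def)
  show "transp hex_sim"
    unfolding transp_def hex_sim_def
    by (meson hex_ident_left_unique hex_ident_no_two_steps hex_ident_right_unique)
qed

text \<open>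
  Only the underlying set of the hexacarpet is formalised: the distances below depend on the
  cells as sets, so the quotient topology plays no role.
\<close>

quotient_type hexacarpet = "letter stream" / hex_sim
  by (rule equivp_hex_sim)

abbreviation hex_proj :: "letter stream \<Rightarrow> hexacarpet" where
  "hex_proj \<equiv> abs_hexacarpet"

lift_definition hex_map :: "letter \<Rightarrow> hexacarpet \<Rightarrow> hexacarpet" is "\<lambda>i w. i ## w"
  by (rule hex_sim_Cons)

lemma hex_map_unique:
  "h = hex_map i \<longleftrightarrow> (\<forall>w. hex_proj (i ## w) = h (hex_proj w))"
proof
  assume h: "\<forall>w. hex_proj (i ## w) = h (hex_proj w)"
  show "h = hex_map i"
  proof
    fix x
    show "h x = hex_map i x"
      by (induction x rule: hexacarpet.abs_induct) (simp add: h[rule_format, symmetric] hex_map.abs_eq)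
  qed
qed (simp add: hex_map.abs_eq)

definition hex_map_word :: "letter list \<Rightarrow> hexacarpet \<Rightarrow> hexacarpet" where
  "hex_map_word w = foldr hex_map w"

definition hex_cell :: "letter list \<Rightarrow> hexacarpet set" where
  "hex_cell w = range (hex_map_word w)"

definition hex_weight :: "real \<Rightarrow> letter list \<Rightarrow> real" where
  "hex_weight \<mu> w = \<mu> ^ length w"

definition hex_chain :: "letter list list \<Rightarrow> bool" where
  "hex_chain ws \<longleftrightarrow> ws \<noteq> [] \<and> successively (\<lambda>u v. hex_cell u \<inter> hex_cell v \<noteq> {}) ws"

definition hex_chains :: "hexacarpet \<Rightarrow> hexacarpet \<Rightarrow> letter list list set" where
  "hex_chains x y = {ws. hex_chain ws \<and> x \<in> hex_cell (hd ws) \<and> y \<in> hex_cell (last ws)}"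

definition hex_dist :: "real \<Rightarrow> hexacarpet \<Rightarrow> hexacarpet \<Rightarrow> real" where
  "hex_dist \<mu> x y = (INF ws\<in>hex_chains x y. \<Sum>w\<leftarrow>ws. hex_weight \<mu> w)"

text \<open>
  The next lemma guards the infimum above against the junk values that \<open>Inf\<close> on the reals
  takes on empty and unbounded sets.
\<close>

lemma hex_dist_well_defined:
  assumes "0 < \<mu>"
  shows "hex_chains x y \<noteq> {}"
    and "bdd_below ((\<lambda>ws. \<Sum>w\<leftarrow>ws. hex_weight \<mu> w) ` hex_chains x y)"
proof -
  have "[[]] \<in> hex_chains x y"
    by (simp add: hex_chains_def hex_chain_def hex_cell_def hex_map_word_def)
  then show "hex_chains x y \<noteq> {}" by blast
  show "bdd_below ((\<lambda>ws. \<Sum>w\<leftarrow>ws. hex_weight \<mu> w) ` hex_chains x y)"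
    using assms by (auto intro!: bdd_belowI[of _ 0] sum_list_nonneg simp: hex_weight_def)
qed

text \<open>The chain conditions for a space with carrier \<open>M\<close> and distance function \<open>d\<close>.\<close>

definition chain_condition :: "'a set \<Rightarrow> ('a \<Rightarrow> 'a \<Rightarrow> real) \<Rightarrow> bool" where
  "chain_condition M d \<longleftrightarrow>
    (\<exists>C>0. \<forall>x\<in>M. \<forall>y\<in>M. \<forall>n\<ge>1. \<exists>z :: nat \<Rightarrow> 'a. z ` {..n} \<subseteq> M \<and> z 0 = x \<and> z n = y \<and>
      (\<forall>i<n. d (z i) (z (i + 1)) \<le> C * (d x y / real n)))"

definition theta_chain_condition :: "real \<Rightarrow> 'a set \<Rightarrow> ('a \<Rightarrow> 'a \<Rightarrow> real) \<Rightarrow> bool" where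
  "theta_chain_condition \<theta> M d \<longleftrightarrow>
    (\<exists>C>0. \<forall>x\<in>M. \<forall>y\<in>M. \<forall>n\<ge>1. \<exists>z :: nat \<Rightarrow> 'a. z ` {..n} \<subseteq> M \<and> z 0 = x \<and> z n = y \<and>
      (\<forall>i<n. d (z i) (z (i + 1)) \<le> C * (d x y / real n powr \<theta>)))"

end

theory Submission
  imports Defs
begin

text \<open>
  The cells of level n are the triangles of the n-th barycentric subdivision of a triangle, and two
  different ones meet if and only if the triangles share an edge. The letters 0 to 5 run around the
  barycentre; the outer edges of a cell are the sides {0, 5}, {1, 2}, {3, 4}, named after the
  subcells that they bound, and its corners lie at the pairs of subcells {0, 1}, {2, 3}, {4, 5}.
  Write l(n) for the number of level n cells that a walk needs to get from one corner of a cell to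
  another. Everything rests on the fact that l(n) has the order of magnitude of n * 2^n. It is not
  of order 2^n, although crossing a cell once from side to side takes only 2^n cells. A walk along
  an edge has to turn around every vertex on it. About 2^j of these vertices are born at level j, each
  has about 2^(n-j) cells of level n around it, and so every level j contributes about 2^n.

  Upper bound, and the chain condition with exponent theta. Turning around a corner takes 2^n cells
  (\<open>turn_at_corner\<close>), walking along an edge (n + 1) * 2^n (\<open>walk_along_side\<close>), and hence any two
  points are joined through at most 20 * (n + 1) * 2^n cells (\<open>share_cell_steps\<close>). Since theta is
  less than -log \<mu> / log 2, this is at most a constant times \<mu> to the power -n / theta. So a cell of
  weight g can be crossed in about (g / \<delta>)^(1 / theta) steps of length \<delta>. To join x and y, take a
  chain whose total weight D is less than twice their distance, set \<delta> = D / n^theta, merge runs of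
  small cells into one step and subdivide the large ones (\<open>steps_along_chain\<close>). As
  1 / theta \<ge> 1, the number of steps is at most a constant times n.

  Lower bound, and the failure of the chain condition. Under the chain condition two fixed points
  would be joined, for every k, by chains of bounded total weight whose cells all have level at
  least k. Since \<mu> \<ge> 1/2, their total weight would be bounded for \<mu> = 1/2 too. Against this
  stands, for every k, a function on the carpet that varies by at most 2^(k - m) on each cell of
  level m \<ge> k (\<open>hex_potential_cell\<close>) but by k * 2^k / 2 between the two corners of an edge
  (\<open>hex_potential_gap\<close>). It is a version of the level k distance from a corner, and is built by
  labelling the edges and the corners of all triangles recursively: the corner labels record the
  position along the edge, and one subdivision step doubles the label of an edge and adds, on
  each half, the label of its corner, which accounts for the turn that a walk needs when it passes
  on to the next vertex.
\<close>

section \<open>Iterated relations\<close>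

lemma relpow_mono_refl:
  assumes "refl R" "m \<le> n" shows "R ^^ m \<subseteq> R ^^ n"
  using assms(2)
proof (induction rule: dec_induct)
  case (step n)
  have "R ^^ n \<subseteq> R ^^ Suc n"
    using assms(1) by (auto simp: refl_on_def)
  with step show ?case by blast
qed simp

lemma sym_relpow:
  assumes "sym R" shows "sym (R ^^ n)"
proof (induction n)
  case (Suc n)
  show ?case
  proof (rule symI)
    fix x y assume "(x, y) \<in> R ^^ Suc n"
    then obtain z where "(x, z) \<in> R ^^ n" "(z, y) \<in> R" by auto
    then have "(z, x) \<in> R ^^ n" "(y, z) \<in> R" using Suc assms by (auto dest: symD)
    then show "(y, x) \<in> R ^^ Suc n" by (rule relpow_Suc_I2[rotated])
  qed
qed (auto simp: sym_def)

lemma relpow_mult: fixes R :: "('a \<times> 'a) set" shows "(R ^^ m) ^^ n = R ^^ (m * n)"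
  by (induction n) (simp_all add: relpow_add[symmetric] add.commute)

lemma relpow_subset: fixes R :: "('a \<times> 'a) set" shows "R \<subseteq> S \<Longrightarrow> R ^^ n \<subseteq> S ^^ n"
  by (induction n) (simp_all add: relcomp_mono)

section \<open>Cells and the distance\<close>

lemma letter_cases:
  fixes c :: letter
  obtains "c = 0" | "c = 1" | "c = 2" | "c = 3" | "c = 4" | "c = 5"
  using UNIV_letter UNIV_I[of c] by blast

lemma hex_proj_surj: obtains z where "x = hex_proj z"
  by (induction x rule: hexacarpet.abs_induct) blast

lemma hex_cell_iff: "x \<in> hex_cell w \<longleftrightarrow> (\<exists>z. x = hex_proj (w @- z))"
proof -
  have *: "hex_map_word w (hex_proj z) = hex_proj (w @- z)" for z
    by (induction w) (simp_all add: hex_map_word_def hex_map.abs_eq)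
  show ?thesis
  proof
    assume "x \<in> hex_cell w"
    then obtain y where "x = hex_map_word w y" by (auto simp: hex_cell_def)
    moreover obtain z where "y = hex_proj z" by (rule hex_proj_surj)
    ultimately show "\<exists>z. x = hex_proj (w @- z)" using * by auto
  next
    assume "\<exists>z. x = hex_proj (w @- z)"
    then show "x \<in> hex_cell w" unfolding hex_cell_def *[symmetric] by blast
  qed
qed

lemma hex_cell_Nil: "hex_cell [] = UNIV"
  by (simp add: hex_cell_def hex_map_word_def)

lemma hex_cell_append: "x \<in> hex_cell (u @ v) \<longleftrightarrow> (\<exists>y\<in>hex_cell v. x = hex_map_word u y)"
  by (auto simp: hex_cell_def hex_map_word_def)

lemma hex_cell_refine: "\<exists>w. length w = n \<and> x \<in> hex_cell w"
proof -
  obtain z where "x = hex_proj z" by (rule hex_proj_surj)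
  then have "x \<in> hex_cell (stake n z)" unfolding hex_cell_iff by (metis stake_sdrop)
  then show ?thesis by (intro exI[of _ "stake n z"]) simp
qed

lemma hex_dist_le_chain:
  assumes "0 < \<mu>" "ws \<in> hex_chains x y"
  shows "hex_dist \<mu> x y \<le> (\<Sum>w\<leftarrow>ws. hex_weight \<mu> w)"
  unfolding hex_dist_def by (rule cINF_lower[OF hex_dist_well_defined(2)]) (use assms in auto)

lemma hex_dist_less_chain:
  assumes "0 < \<mu>" "hex_dist \<mu> x y < t"
  obtains ws where "ws \<in> hex_chains x y" "(\<Sum>w\<leftarrow>ws. hex_weight \<mu> w) < t"
  using cINF_less_iff[OF hex_dist_well_defined[OF assms(1)]] assms(2)
  unfolding hex_dist_def by blast

lemma hex_dist_cell:
  assumes "0 < \<mu>" "x \<in> hex_cell w" "y \<in> hex_cell w"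
  shows "hex_dist \<mu> x y \<le> \<mu> ^ length w"
  using hex_dist_le_chain[of \<mu> "[w]" x y] assms
  by (simp add: hex_chains_def hex_chain_def hex_weight_def)

lemma hex_dist_nonneg: "0 < \<mu> \<Longrightarrow> 0 \<le> hex_dist \<mu> x y"
  unfolding hex_dist_def using hex_dist_well_defined(1)
  by (intro cINF_greatest sum_list_nonneg) (auto simp: hex_weight_def)

text \<open>
  Every point lies in cells of arbitrarily small weight.
\<close>

lemma hex_dist_self:
  assumes "0 < \<mu>" "\<mu> < 1" shows "hex_dist \<mu> x x = 0"
proof (rule ccontr)
  assume "hex_dist \<mu> x x \<noteq> 0"
  then have "0 < hex_dist \<mu> x x" using hex_dist_nonneg[of \<mu> x x] assms by simp
  then obtain n where "\<mu> ^ n < hex_dist \<mu> x x" using assms(2) real_arch_pow_inv by blast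
  moreover obtain w where "length w = n" "x \<in> hex_cell w" using hex_cell_refine by blast
  ultimately show False using hex_dist_cell[of \<mu> x w x] assms by simp
qed

lemma hex_dist_triangle:
  assumes "0 < \<mu>" shows "hex_dist \<mu> x z \<le> hex_dist \<mu> x y + hex_dist \<mu> y z"
proof (rule field_le_epsilon)
  fix e :: real assume "0 < e"
  obtain us where us: "us \<in> hex_chains x y" "(\<Sum>w\<leftarrow>us. hex_weight \<mu> w) < hex_dist \<mu> x y + e / 2"
    using hex_dist_less_chain[OF assms, of x y "hex_dist \<mu> x y + e / 2"] \<open>0 < e\<close> by auto
  obtain vs where vs: "vs \<in> hex_chains y z" "(\<Sum>w\<leftarrow>vs. hex_weight \<mu> w) < hex_dist \<mu> y z + e / 2"
    using hex_dist_less_chain[OF assms, of y z "hex_dist \<mu> y z + e / 2"] \<open>0 < e\<close> by auto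
  have "us @ vs \<in> hex_chains x z"
    using us(1) vs(1) by (auto simp: hex_chains_def hex_chain_def successively_append_iff)
  from hex_dist_le_chain[OF assms this] us(2) vs(2)
  show "hex_dist \<mu> x z \<le> hex_dist \<mu> x y + hex_dist \<mu> y z + e" by simp
qed

section \<open>Walks through cells of one level\<close>

definition share_cell :: "nat \<Rightarrow> (hexacarpet \<times> hexacarpet) set" where
  "share_cell n = {(x, y). \<exists>w. length w = n \<and> x \<in> hex_cell w \<and> y \<in> hex_cell w}"

lemma refl_share_cell: "refl (share_cell n)"
  using hex_cell_refine by (auto simp: refl_on_def share_cell_def)

lemma sym_share_cell: "sym (share_cell n)"
  by (auto simp: sym_def share_cell_def)

text \<open>
  Self-similarity: a walk in the whole carpet becomes, inside a cell, a walk at a deeper level with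
  the same number of steps.
\<close>

lemma share_cell_map_word:
  assumes "(x, y) \<in> share_cell n ^^ m"
  shows "(hex_map_word w x, hex_map_word w y) \<in> share_cell (length w + n) ^^ m"
  using assms
proof (induction m arbitrary: y)
  case (Suc m)
  then obtain z where z: "(x, z) \<in> share_cell n ^^ m" "(z, y) \<in> share_cell n" by auto
  then obtain u where "length u = n" "z \<in> hex_cell u" "y \<in> hex_cell u"
    by (auto simp: share_cell_def)
  then have "(hex_map_word w z, hex_map_word w y) \<in> share_cell (length w + n)"
    unfolding share_cell_def by (auto intro!: exI[of _ "w @ u"] simp: hex_cell_append)
  with Suc.IH[OF z(1)] show ?case by auto
qed simp

lemma share_cell_map:
  "(x, y) \<in> share_cell n ^^ m \<Longrightarrow> (hex_map i x, hex_map i y) \<in> share_cell (Suc n) ^^ m"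
  using share_cell_map_word[of x y m n "[i]"] by (simp add: hex_map_word_def)

text \<open>
  The corner of the carpet at the subcells 0 and 1, approached along the side {0, 5}. A corner of a
  triangle gives two points of the carpet, one on each of the two sides that meet there. The six
  points that arise in this way are the images of this one under the six maps.
\<close>

definition base_point :: hexacarpet where
  "base_point = hex_proj (sconst 0)"

lemma base_point_fixed: "hex_map 0 base_point = base_point"
proof -
  have "0 ## sconst 0 = (sconst 0 :: letter stream)" by (subst (2) siterate.ctr) simp
  then show ?thesis by (simp add: base_point_def hex_map.abs_eq)
qed

lemma glue_even:
  "i \<in> {0, 2, 4} \<Longrightarrow> hex_map i (hex_map 1 base_point) = hex_map (i + 1) (hex_map 1 base_point)"
  unfolding base_point_def hex_map.abs_eq
  using hex_ident.even[of i 1 "sconst 0" "[]"] by (auto simp: hexacarpet.abs_eq_iff hex_sim_def)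

lemma glue_odd:
  "i \<in> {1, 3, 5} \<Longrightarrow> hex_map i (hex_map 4 base_point) = hex_map (i + 1) (hex_map 4 base_point)"
  unfolding base_point_def hex_map.abs_eq
  using hex_ident.odd[of i 4 "sconst 0" "[]"] by (auto simp: hexacarpet.abs_eq_iff hex_sim_def)

text \<open>
  The walk turns around the corner at the subcells 0 and 1, from one side to the other. At the next
  level it turns around the same corner within subcell 0 and then, backwards, within subcell 1.
\<close>

lemma turn_at_base:
  "(base_point, hex_map 1 base_point) \<in> share_cell n ^^ (2 ^ n)"
proof (induction n)
  case 0
  show ?case by (simp add: share_cell_def hex_cell_Nil)
next
  case (Suc n)
  let ?a = base_point and ?R = "share_cell (Suc n)"
  have "(?a, hex_map 0 (hex_map 1 ?a)) \<in> ?R ^^ (2 ^ n)"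
    using share_cell_map[OF Suc, of 0] by (simp add: base_point_fixed)
  moreover have "(hex_map 1 (hex_map 1 ?a), hex_map 1 ?a) \<in> ?R ^^ (2 ^ n)"
    by (rule share_cell_map[OF symD[OF sym_relpow[OF sym_share_cell] Suc]])
  moreover have "hex_map 0 (hex_map 1 ?a) = hex_map 1 (hex_map 1 ?a)"
    using glue_even[of 0] by simp
  ultimately show ?case using relpow_trans by (fastforce simp: mult_2)
qed

lemma turn_at_corner:
  assumes "i \<in> {0, 2, 4}"
  shows "(hex_map i base_point, hex_map (i + 1) base_point) \<in> share_cell n ^^ (2 ^ n)"
proof (cases n)
  case 0
  then show ?thesis by (simp add: share_cell_def hex_cell_Nil)
next
  case (Suc m)
  let ?a = base_point and ?R = "share_cell (Suc m)"
  have "(hex_map i ?a, hex_map i (hex_map 1 ?a)) \<in> ?R ^^ (2 ^ m)"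
    by (rule share_cell_map[OF turn_at_base])
  moreover have "(hex_map (i + 1) (hex_map 1 ?a), hex_map (i + 1) ?a) \<in> ?R ^^ (2 ^ m)"
    by (rule share_cell_map[OF symD[OF sym_relpow[OF sym_share_cell] turn_at_base]])
  ultimately show ?thesis using glue_even[OF assms] relpow_trans Suc by (fastforce simp: mult_2)
qed

text \<open>
  The side that bounds the subcells i and i + 1 has its midpoint between them. The walk runs along
  half of the side within subcell i, turns around the midpoint in both subcells, and runs along the
  other half in subcell i + 1, so the number a(n) of its steps satisfies a(n + 1) = 2 a(n) + 2 * 2^n.
  The additional term makes it grow faster than 2^n.
\<close>

lemma walk_along_side:
  assumes "i \<in> {1, 3, 5}"
  shows "(hex_map i base_point, hex_map (i + 1) base_point) \<in> share_cell n ^^ ((n + 1) * 2 ^ n)"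
  using assms
proof (induction n arbitrary: i)
  case 0
  then show ?case by (simp add: share_cell_def hex_cell_Nil)
next
  case (Suc n)
  let ?a = base_point and ?R = "share_cell n"
  have "(hex_map 5 ?a, ?a) \<in> ?R ^^ ((n + 1) * 2 ^ n)"
  proof -
    have "(5 :: letter) + 1 = 0" by simp
    then show ?thesis using Suc.IH[of 5] base_point_fixed by (metis insertI1 insertI2)
  qed
  moreover have "(hex_map 4 ?a, hex_map 5 ?a) \<in> ?R ^^ (2 ^ n)"
    using turn_at_corner[of 4] by simp
  ultimately have *: "(hex_map 4 ?a, ?a) \<in> ?R ^^ (2 ^ n + (n + 1) * 2 ^ n)"
    by (rule relpow_trans[rotated])
  from share_cell_map[OF symD[OF sym_relpow[OF sym_share_cell] *], of i]
    share_cell_map[OF *, of "i + 1"] glue_odd[OF Suc.prems]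
  have "(hex_map i ?a, hex_map (i + 1) ?a) \<in>
      share_cell (Suc n) ^^ ((2 ^ n + (n + 1) * 2 ^ n) + (2 ^ n + (n + 1) * 2 ^ n))"
    by (metis relpow_trans)
  moreover have "(2 ^ n + (n + 1) * 2 ^ n) + (2 ^ n + (n + 1) * 2 ^ n) = (Suc n + 1) * 2 ^ Suc n"
    by (simp add: algebra_simps)
  ultimately show ?case by (simp only:)
qed

text \<open>
  The six corner points form a ring whose neighbours are joined alternately by a turn around a corner
  and a walk along a side.
\<close>

lemma corner_to_base:
  "(hex_map i base_point, base_point) \<in> share_cell n ^^ (5 * ((n + 1) * 2 ^ n))"
proof -
  let ?a = base_point and ?c = "(n + 1) * 2 ^ n" and ?R = "share_cell n"
  have turn: "(hex_map i ?a, hex_map (i + 1) ?a) \<in> ?R ^^ ?c" for i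
  proof -
    have "i \<in> {0, 2, 4} \<or> i \<in> {1, 3, 5}" using UNIV_letter UNIV_I[of i] by auto
    then show ?thesis
      using walk_along_side[of i n] turn_at_corner[of i n]
        relpow_mono_refl[OF refl_share_cell, of "2 ^ n" ?c n] by auto
  qed
  have walk: "(hex_map i ?a, hex_map (i + of_nat k) ?a) \<in> ?R ^^ (k * ?c)" for i k
  proof (induction k)
    case (Suc k)
    from relpow_trans[OF Suc turn[of "i + of_nat k"]] show ?case
      by (simp add: algebra_simps)
  qed simp
  have "\<exists>k\<le>5. i + of_nat k = 0"
  proof (cases i rule: letter_cases)
    case 1
    then show ?thesis by (intro exI[of _ 0]) simp
  next
    case 2
    then show ?thesis by (intro exI[of _ 5]) simp
  next
    case 3
    then show ?thesis by (intro exI[of _ 4]) simp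
  next
    case 4
    then show ?thesis by (intro exI[of _ 3]) simp
  next
    case 5
    then show ?thesis by (intro exI[of _ 2]) simp
  next
    case 6
    then show ?thesis by (intro exI[of _ 1]) simp
  qed
  then obtain k where k: "k \<le> 5" "i + of_nat k = 0" by blast
  have "?R ^^ (k * ?c) \<subseteq> ?R ^^ (5 * ?c)"
    using k(1) by (intro relpow_mono_refl refl_share_cell mult_right_mono) auto
  then show ?thesis using walk[of i k] k(2) base_point_fixed by auto
qed

text \<open>
  A point of subcell i first moves to the corner point of that subcell and from there to the base
  point. The sum of the costs over all levels is dominated by a multiple of the last one.
\<close>

lemma reach_base: "(x, base_point) \<in> share_cell n ^^ (10 * ((n + 1) * 2 ^ n))"
proof (induction n arbitrary: x)
  case 0
  have "(x, base_point) \<in> share_cell 0 ^^ 1" by (simp add: share_cell_def hex_cell_Nil)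
  then show ?case using relpow_mono_refl[OF refl_share_cell, of 1 10 0] by auto
next
  case (Suc n)
  obtain z where z: "x = hex_proj z" by (rule hex_proj_surj)
  define i y where "i = shd z" and "y = hex_proj (stl z)"
  have x: "x = hex_map i y" by (simp add: z i_def y_def hex_map.abs_eq)
  from relpow_trans[OF share_cell_map[OF Suc[of y], of i] corner_to_base[of i "Suc n"]]
  have "(x, base_point) \<in> share_cell (Suc n) ^^
      (10 * ((n + 1) * 2 ^ n) + 5 * ((Suc n + 1) * 2 ^ Suc n))" by (simp add: x)
  moreover have "10 * ((n + 1) * 2 ^ n) + 5 * ((Suc n + 1) * 2 ^ Suc n) \<le> 10 * ((Suc n + 1) * 2 ^ Suc n)"
    by (simp add: algebra_simps)
  ultimately show ?case using relpow_mono_refl[OF refl_share_cell] by blast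
qed

lemma share_cell_steps: "(x, y) \<in> share_cell n ^^ (20 * ((n + 1) * 2 ^ n))"
  using relpow_trans[OF reach_base[of x n] symD[OF sym_relpow[OF sym_share_cell] reach_base[of y n]]]
  by simp

section \<open>The chain condition with an exponent\<close>

definition close_pairs :: "real \<Rightarrow> real \<Rightarrow> (hexacarpet \<times> hexacarpet) set" where
  "close_pairs \<mu> \<delta> = {(x, y). hex_dist \<mu> x y \<le> \<delta>}"

lemma refl_close_pairs: "0 < \<mu> \<Longrightarrow> \<mu> < 1 \<Longrightarrow> 0 \<le> \<delta> \<Longrightarrow> refl (close_pairs \<mu> \<delta>)"
  by (auto simp: refl_on_def close_pairs_def hex_dist_self)

lemma share_cell_close:
  assumes "0 < \<mu>" "\<mu> ^ n \<le> \<delta>" shows "share_cell n \<subseteq> close_pairs \<mu> \<delta>"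
  unfolding share_cell_def close_pairs_def using hex_dist_cell[OF assms(1)] assms(2) by fastforce

lemma close_relpow:
  assumes "0 < \<mu>" "\<mu> < 1" shows "close_pairs \<mu> \<delta> ^^ n \<subseteq> close_pairs \<mu> (real n * \<delta>)"
proof (induction n)
  case 0
  then show ?case using assms by (auto simp: close_pairs_def hex_dist_self)
next
  case (Suc n)
  show ?case
  proof (rule subrelI)
    fix x z assume "(x, z) \<in> close_pairs \<mu> \<delta> ^^ Suc n"
    then obtain y where "(x, y) \<in> close_pairs \<mu> \<delta> ^^ n" "(y, z) \<in> close_pairs \<mu> \<delta>" by auto
    then have "hex_dist \<mu> x y \<le> real n * \<delta>" "hex_dist \<mu> y z \<le> \<delta>"
      using Suc by (auto simp: close_pairs_def)
    then show "(x, z) \<in> close_pairs \<mu> (real (Suc n) * \<delta>)"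
      using hex_dist_triangle[OF assms(1), of x z y] by (simp add: close_pairs_def algebra_simps)
  qed
qed

lemma linear_times_geometric_bounded:
  fixes b :: real
  assumes "2 < b"
  obtains c where "0 < c" "\<And>n. real (20 * ((n + 1) * 2 ^ n)) \<le> c * b ^ n"
proof -
  have "(\<lambda>n. of_nat n * (2 / b) ^ n) \<longlonglongrightarrow> 0"
    using assms by (intro powser_times_n_limit_0) simp
  moreover have "(\<lambda>n. (2 / b) ^ n) \<longlonglongrightarrow> 0"
    using assms by (intro LIMSEQ_power_zero) simp
  ultimately have "(\<lambda>n. real n * (2 / b) ^ n + (2 / b) ^ n) \<longlonglongrightarrow> 0 + 0"
    by (intro tendsto_add) auto
  then have "Bseq (\<lambda>n. real n * (2 / b) ^ n + (2 / b) ^ n)"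
    by (intro convergent_imp_Bseq) (auto simp: convergent_def)
  then obtain c where c: "0 < c" "\<And>n. norm (real n * (2 / b) ^ n + (2 / b) ^ n) \<le> c"
    by (auto simp: Bseq_def)
  have "real (20 * ((n + 1) * 2 ^ n)) \<le> 20 * c * b ^ n" for n
  proof -
    have "real n * (2 / b) ^ n + (2 / b) ^ n \<le> c" using c(2)[of n] by simp
    then have "(real n * (2 / b) ^ n + (2 / b) ^ n) * b ^ n \<le> c * b ^ n"
      using assms by (intro mult_right_mono) auto
    moreover have "(2 / b) ^ n * b ^ n = 2 ^ n" using assms by (simp add: power_divide)
    ultimately show ?thesis by (simp add: distrib_right mult.assoc)
  qed
  then show ?thesis using c(1) that[of "20 * c"] by simp
qed

text \<open>
  With b = \<mu>^(-1 / theta) the hypothesis on theta says that b > 2, so b^n outgrows the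
  20 * (n + 1) * 2^n steps that suffice at relative level n. Here n is the first level at which the
  subcells have weight at most \<delta>, which gives the exponent 1 / theta.
\<close>

lemma steps_in_cell:
  assumes "0 < \<mu>" "\<mu> < 1" "0 < \<theta>" "\<theta> < - ln \<mu> / ln 2"
  obtains c where "0 < c"
    "\<And>w x y \<delta>. 0 < \<delta> \<Longrightarrow> x \<in> hex_cell w \<Longrightarrow> y \<in> hex_cell w \<Longrightarrow>
      \<exists>m. real m \<le> 1 + c * (\<mu> ^ length w / \<delta>) powr (1 / \<theta>) \<and> (x, y) \<in> close_pairs \<mu> \<delta> ^^ m"
proof -
  define b where "b = (1 / \<mu>) powr (1 / \<theta>)"
  have "\<theta> * ln 2 < - ln \<mu>" using assms by (simp add: field_simps)
  then have "ln 2 < ln b" using assms by (simp add: b_def ln_powr ln_div field_simps)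
  then have b: "2 < b" using assms by (subst (asm) ln_less_cancel_iff) (auto simp: b_def)
  obtain c where c: "0 < c" "\<And>n. real (20 * ((n + 1) * 2 ^ n)) \<le> c * b ^ n"
    using linear_times_geometric_bounded[OF b] by blast
  have "\<exists>m. real m \<le> 1 + (c * b) * (\<mu> ^ length w / \<delta>) powr (1 / \<theta>) \<and> (x, y) \<in> close_pairs \<mu> \<delta> ^^ m"
    if \<delta>: "0 < \<delta>" and x: "x \<in> hex_cell w" and y: "y \<in> hex_cell w" for w x y \<delta>
  proof -
    obtain n0 where "\<mu> ^ n0 < \<delta>" using real_arch_pow_inv[OF \<delta> assms(2)] by blast
    moreover have "\<mu> ^ (length w + n0) \<le> \<mu> ^ n0" using assms by (intro power_decreasing) auto
    ultimately have ex: "\<exists>n. \<mu> ^ (length w + n) \<le> \<delta>" by (meson less_imp_le order_trans)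
    define n where "n = (LEAST n. \<mu> ^ (length w + n) \<le> \<delta>)"
    have n: "\<mu> ^ (length w + n) \<le> \<delta>" unfolding n_def using ex by (rule LeastI_ex)
    show ?thesis
    proof (cases n)
      case 0
      then have "(x, y) \<in> close_pairs \<mu> \<delta> ^^ 1"
        using hex_dist_cell[OF assms(1) x y] n by (simp add: close_pairs_def)
      then show ?thesis using c(1) b by (intro exI[of _ 1]) simp
    next
      case (Suc j)
      have "\<not> \<mu> ^ (length w + j) \<le> \<delta>"
        using not_less_Least[of j "\<lambda>n. \<mu> ^ (length w + n) \<le> \<delta>"] Suc by (simp add: n_def)
      then have "(1 / \<mu>) ^ j \<le> \<mu> ^ length w / \<delta>"
        using assms(1) \<delta> by (simp add: power_add field_simps)
      then have "((1 / \<mu>) ^ j) powr (1 / \<theta>) \<le> (\<mu> ^ length w / \<delta>) powr (1 / \<theta>)"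
        using assms by (intro powr_mono2) auto
      moreover have "((1 / \<mu>) ^ j) powr (1 / \<theta>) = b ^ j"
        using assms(1) by (simp add: b_def powr_powr mult.commute flip: powr_realpow)
      ultimately have bj: "b ^ n \<le> b * (\<mu> ^ length w / \<delta>) powr (1 / \<theta>)"
        using b Suc by simp
      obtain x' y' where xy: "x = hex_map_word w x'" "y = hex_map_word w y'"
        using x y by (auto simp: hex_cell_def)
      have "(x, y) \<in> share_cell (length w + n) ^^ (20 * ((n + 1) * 2 ^ n))"
        unfolding xy by (rule share_cell_map_word[OF share_cell_steps])
      then have "(x, y) \<in> close_pairs \<mu> \<delta> ^^ (20 * ((n + 1) * 2 ^ n))"
        using relpow_subset[OF share_cell_close[OF assms(1) n]] by blast
      moreover have "real (20 * ((n + 1) * 2 ^ n)) \<le> c * (b * (\<mu> ^ length w / \<delta>) powr (1 / \<theta>))"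
        using c(2)[of n] mult_left_mono[OF bj, of c] c(1) by linarith
      ultimately show ?thesis
        by (intro exI[of _ "20 * ((n + 1) * 2 ^ n)"]) (simp add: mult.assoc)
    qed
  qed
  then show ?thesis using that[of "c * b"] c(1) b by simp
qed

text \<open>
  The walk follows the chain greedily. The point x0 is where the last step ended and t bounds the
  length of the part of the chain that has been passed since then. If the next cell keeps that length
  within \<delta>, it is absorbed; otherwise one step closes the gap and the cell is crossed by
  itself. The term 2 g / \<delta> pays for these extra steps, because at least the length \<delta> is
  used up each time.
\<close>

lemma steps_along_chain:
  assumes "0 < \<mu>" "\<mu> < 1" "0 < \<delta>"
    and B: "\<And>w. 0 \<le> B w"
    and cell: "\<And>w x y. x \<in> hex_cell w \<Longrightarrow> y \<in> hex_cell w \<Longrightarrow>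
      \<exists>m. real m \<le> 1 + B w \<and> (x, y) \<in> close_pairs \<mu> \<delta> ^^ m"
    and "ws \<in> hex_chains x y" "hex_dist \<mu> x0 x \<le> t" "t \<le> \<delta>"
  shows "\<exists>m. real m \<le> 2 + 2 * t / \<delta> + (\<Sum>w\<leftarrow>ws. 2 * hex_weight \<mu> w / \<delta> + B w) \<and>
    (x0, y) \<in> close_pairs \<mu> \<delta> ^^ m"
  using assms(6-)
proof (induction ws arbitrary: x x0 t)
  case Nil
  then show ?case by (simp add: hex_chains_def hex_chain_def)
next
  case (Cons w ws)
  have x: "x \<in> hex_cell w" using Cons.prems by (simp add: hex_chains_def)
  have t: "0 \<le> t" using Cons.prems hex_dist_nonneg[OF assms(1), of x0 x] by linarith
  have first: "(x0, x) \<in> close_pairs \<mu> \<delta> ^^ 1" using Cons.prems by (simp add: close_pairs_def)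
  show ?case
  proof (cases "ws = []")
    case True
    then have "y \<in> hex_cell w" using Cons.prems by (simp add: hex_chains_def)
    then obtain m where m: "real m \<le> 1 + B w" "(x, y) \<in> close_pairs \<mu> \<delta> ^^ m"
      using cell[OF x] by blast
    have "(x0, y) \<in> close_pairs \<mu> \<delta> ^^ (1 + m)" by (rule relpow_trans[OF first m(2)])
    moreover have "0 \<le> t / \<delta>" "0 \<le> hex_weight \<mu> w / \<delta>"
      using t assms by (simp_all add: hex_weight_def)
    ultimately show ?thesis using m(1) True by (intro exI[of _ "1 + m"]) simp
  next
    case False
    then obtain p where p: "p \<in> hex_cell w" "ws \<in> hex_chains p y"
      using Cons.prems(1) by (auto simp: hex_chains_def hex_chain_def successively_Cons)
    show ?thesis
    proof (cases "t + hex_weight \<mu> w \<le> \<delta>")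
      case True
      have "hex_dist \<mu> x0 p \<le> t + hex_weight \<mu> w"
        using hex_dist_triangle[OF assms(1), of x0 p x] hex_dist_cell[OF assms(1) x p(1)] Cons.prems
        by (simp add: hex_weight_def)
      from Cons.IH[OF p(2) this True] obtain m where
        m: "real m \<le> 2 + 2 * (t + hex_weight \<mu> w) / \<delta> + (\<Sum>w\<leftarrow>ws. 2 * hex_weight \<mu> w / \<delta> + B w)"
          "(x0, y) \<in> close_pairs \<mu> \<delta> ^^ m" by blast
      with B[of w] show ?thesis
        by (intro exI[of _ m]) (simp add: add_divide_distrib distrib_left)
    next
      case False
      have "hex_dist \<mu> p p \<le> 0" using assms by (simp add: hex_dist_self)
      from Cons.IH[OF p(2) this] assms(3) obtain m where
        m: "real m \<le> 2 + (\<Sum>w\<leftarrow>ws. 2 * hex_weight \<mu> w / \<delta> + B w)" "(p, y) \<in> close_pairs \<mu> \<delta> ^^ m"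
        by auto
      obtain k where k: "real k \<le> 1 + B w" "(x, p) \<in> close_pairs \<mu> \<delta> ^^ k"
        using cell[OF x p(1)] by blast
      have "(x0, y) \<in> close_pairs \<mu> \<delta> ^^ (1 + k + m)"
        by (rule relpow_trans[OF relpow_trans[OF first k(2)] m(2)])
      moreover have "1 \<le> (t + hex_weight \<mu> w) / \<delta>" using False assms(3) by simp
      ultimately show ?thesis using m(1) k(1)
        by (intro exI[of _ "1 + k + m"]) (simp add: add_divide_distrib)
    qed
  qed
qed

text \<open>
  With \<delta> = D / n^theta the cells of a chain of weight D take at most a constant times
  D / \<delta> + n * (the sum of (g / D)^(1 / theta)) steps of length \<delta>. Both terms are at most n,
  because \<mu> \<ge> 1/2 makes theta less than 1.
\<close>

lemma theta_chain_condition_hex_dist: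
  assumes "1 / 2 \<le> \<mu>" "\<mu> < 1" "0 < \<theta>" "\<theta> < - ln \<mu> / ln 2"
  shows "theta_chain_condition \<theta> (UNIV :: hexacarpet set) (hex_dist \<mu>)"
proof -
  have \<mu>: "0 < \<mu>" using assms by simp
  have "ln (1 / 2) \<le> ln \<mu>" using assms by (subst ln_le_cancel_iff) auto
  then have "- ln \<mu> / ln 2 \<le> 1" by (simp add: ln_div field_simps)
  then have \<theta>: "\<theta> < 1" using assms(4) by linarith
  obtain c where c: "0 < c"
    "\<And>w x y \<delta>. 0 < \<delta> \<Longrightarrow> x \<in> hex_cell w \<Longrightarrow> y \<in> hex_cell w \<Longrightarrow>
      \<exists>m. real m \<le> 1 + c * (\<mu> ^ length w / \<delta>) powr (1 / \<theta>) \<and> (x, y) \<in> close_pairs \<mu> \<delta> ^^ m"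
    using steps_in_cell[OF \<mu> assms(2-4)] by blast
  define K where "K = nat \<lceil>4 + c\<rceil>"
  have K: "4 + c \<le> real K" unfolding K_def by (rule real_nat_ceiling_ge)
  have "\<exists>z :: nat \<Rightarrow> hexacarpet. z ` {..n} \<subseteq> UNIV \<and> z 0 = x \<and> z n = y \<and>
      (\<forall>i<n. hex_dist \<mu> (z i) (z (i + 1)) \<le> (2 * real K) * (hex_dist \<mu> x y / real n powr \<theta>))"
    if n: "n \<ge> 1" for x y and n :: nat
  proof (cases "hex_dist \<mu> x y = 0")
    case True
    \<comment> \<open>Points at distance zero: one step suffices, and the walk then rests at y.\<close>
    then show ?thesis using n
      by (intro exI[of _ "\<lambda>i. if i = 0 then x else y"]) (auto simp: hex_dist_self[OF \<mu> assms(2)])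
  next
    case False
    then have d: "0 < hex_dist \<mu> x y" using hex_dist_nonneg[OF \<mu>, of x y] by simp
    then obtain ws where ws: "ws \<in> hex_chains x y"
      "(\<Sum>w\<leftarrow>ws. hex_weight \<mu> w) < 2 * hex_dist \<mu> x y"
      using hex_dist_less_chain[OF \<mu>, of x y "2 * hex_dist \<mu> x y"] by auto
    define D where "D = (\<Sum>w\<leftarrow>ws. hex_weight \<mu> w)"
    have D: "0 < D" using d hex_dist_le_chain[OF \<mu> ws(1)] by (simp add: D_def)
    define \<delta> where "\<delta> = D / real n powr \<theta>"
    have np: "0 < real n powr \<theta>" using n by simp
    have \<delta>: "0 < \<delta>" using D np by (simp add: \<delta>_def)
    let ?B = "\<lambda>w. c * (hex_weight \<mu> w / \<delta>) powr (1 / \<theta>)"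
    have cell: "\<exists>m. real m \<le> 1 + ?B w \<and> (x, y) \<in> close_pairs \<mu> \<delta> ^^ m"
      if "x \<in> hex_cell w" "y \<in> hex_cell w" for w x y
      using c(2)[OF \<delta> that] by (simp add: hex_weight_def)
    have B: "?B w \<le> c * real n * (hex_weight \<mu> w / D)" if "w \<in> set ws" for w
    proof -
      \<comment> \<open>The share of w in D is at most 1, so its power with exponent 1 / theta \<ge> 1 is at most the share.\<close>
      have "hex_weight \<mu> w \<le> D"
        unfolding D_def using that \<mu> by (intro member_le_sum_list) (auto simp: hex_weight_def)
      then have le: "0 \<le> hex_weight \<mu> w / D" "hex_weight \<mu> w / D \<le> 1"
        using D \<mu> by (simp_all add: hex_weight_def)
      have "hex_weight \<mu> w / \<delta> = hex_weight \<mu> w / D * real n powr \<theta>"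
        by (simp add: \<delta>_def)
      then have "(hex_weight \<mu> w / \<delta>) powr (1 / \<theta>) = (hex_weight \<mu> w / D) powr (1 / \<theta>) * real n"
        using le n assms(3) by (simp only: powr_mult) (simp add: powr_powr)
      also have "(hex_weight \<mu> w / D) powr (1 / \<theta>) \<le> (hex_weight \<mu> w / D) powr 1"
        using le \<theta> assms(3) by (intro powr_mono') auto
      finally have "(hex_weight \<mu> w / \<delta>) powr (1 / \<theta>) \<le> (hex_weight \<mu> w / D) * real n"
        using D \<mu> by (simp add: mult_right_mono hex_weight_def)
      from mult_left_mono[OF this, of c] show ?thesis using c(1)
        by (simp add: ac_simps)
    qed
    have "hex_dist \<mu> x x \<le> 0" using assms \<mu> by (simp add: hex_dist_self)
    moreover have "0 \<le> ?B w" for w using c(1) by simp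
    ultimately obtain m where
      m: "real m \<le> 2 + (\<Sum>w\<leftarrow>ws. 2 * hex_weight \<mu> w / \<delta> + ?B w)" "(x, y) \<in> close_pairs \<mu> \<delta> ^^ m"
      using steps_along_chain[OF \<mu> assms(2) \<delta>, of ?B ws x y x 0] cell ws(1) \<delta> by auto
    have "(\<Sum>w\<leftarrow>ws. 2 * hex_weight \<mu> w / \<delta> + ?B w) \<le>
        (\<Sum>w\<leftarrow>ws. (2 * real n powr \<theta> / D + c * real n / D) * hex_weight \<mu> w)"
    proof (rule sum_list_mono)
      fix w assume "w \<in> set ws"
      moreover have "2 * hex_weight \<mu> w / \<delta> = 2 * real n powr \<theta> / D * hex_weight \<mu> w"
        by (simp add: \<delta>_def)
      ultimately show "2 * hex_weight \<mu> w / \<delta> + ?B w \<le>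
          (2 * real n powr \<theta> / D + c * real n / D) * hex_weight \<mu> w"
        using B by (simp add: distrib_right)
    qed
    also have "\<dots> = 2 * real n powr \<theta> + c * real n"
      using D by (simp only: sum_list_const_mult D_def[symmetric]) (simp add: field_simps)
    also have "real n powr \<theta> \<le> real n powr 1" using n \<theta> by (intro powr_mono) auto
    finally have "real m \<le> 2 + (2 + c) * real n" using m(1) n by (simp add: algebra_simps)
    also have "\<dots> \<le> (4 + c) * real n" using n by (simp add: algebra_simps)
    also have "\<dots> \<le> real K * real n" using K by (intro mult_right_mono) auto
    finally have "m \<le> K * n" by (simp flip: of_nat_mult)
    then have "(x, y) \<in> close_pairs \<mu> \<delta> ^^ (K * n)"
      using relpow_mono_refl[OF refl_close_pairs[OF \<mu> assms(2)]] \<delta> m(2) by (meson less_imp_le subsetD)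
    \<comment> \<open>Group the K * n short steps into n blocks of K steps.\<close>
    then have "(x, y) \<in> (close_pairs \<mu> \<delta> ^^ K) ^^ n" by (simp add: relpow_mult)
    then have "(x, y) \<in> close_pairs \<mu> (real K * \<delta>) ^^ n"
      using relpow_subset[OF close_relpow[OF \<mu> assms(2)]] by blast
    then obtain z where z: "z 0 = x" "z n = y" "\<forall>i<n. (z i, z (Suc i)) \<in> close_pairs \<mu> (real K * \<delta>)"
      by (auto simp: relpow_fun_conv)
    have "\<delta> \<le> 2 * hex_dist \<mu> x y / real n powr \<theta>"
      unfolding \<delta>_def using ws(2) np by (intro divide_right_mono) (auto simp: D_def)
    then have "real K * \<delta> \<le> (2 * real K) * (hex_dist \<mu> x y / real n powr \<theta>)"
      using mult_left_mono[of \<delta> "2 * hex_dist \<mu> x y / real n powr \<theta>" "real K"] by (simp add: ac_simps)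
    then show ?thesis using z by (intro exI[of _ z]) (fastforce simp: close_pairs_def)
  qed
  moreover have "0 < 2 * real K" using K c(1) by simp
  ultimately show ?thesis unfolding theta_chain_condition_def by blast
qed

section \<open>Depth below a side\<close>

text \<open>
  The depth is a function on a cell that vanishes on the side {0, 5}, equals 1 on the other two sides,
  equals 1/2 on all edges between subcells, and varies by at most 2^(-m) on every subcell of relative
  level m. The recursion \<open>depth_Cons\<close> gives all of this. It complements all later binary
  digits at every letter outside {0, 5}, so the binary digits of the depth are the prefix
  parities of the letters outside {0, 5}, as in a Gray code.
\<close>

primrec gray_digit :: "nat \<Rightarrow> letter stream \<Rightarrow> bool" where
  "gray_digit 0 z \<longleftrightarrow> shd z \<notin> {0, 5}"
| "gray_digit (Suc n) z \<longleftrightarrow> (shd z \<notin> {0, 5}) \<noteq> gray_digit n (stl z)"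

definition depth :: "letter stream \<Rightarrow> real" where
  "depth z = (\<Sum>n. of_bool (gray_digit n z) * (1 / 2) ^ Suc n)"

lemma depth_summable: "summable (\<lambda>n. of_bool (gray_digit n z) * (1 / 2) ^ Suc n :: real)"
  by (rule summable_comparison_test'[OF sums_summable[OF power_half_series], of 0]) simp

lemma depth_range: "0 \<le> depth z" "depth z \<le> 1"
proof -
  show "0 \<le> depth z"
    unfolding depth_def by (rule suminf_nonneg[OF depth_summable]) simp
  have "depth z \<le> (\<Sum>n. (1 / 2) ^ Suc n)"
    unfolding depth_def
    by (rule suminf_le[OF _ depth_summable sums_summable[OF power_half_series]]) simp
  then show "depth z \<le> 1" using sums_unique[OF power_half_series] by simp
qed

lemma depth_Cons: "depth (c ## z) = (if c \<in> {0, 5} then depth z / 2 else 1 - depth z / 2)"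
proof -
  let ?f = "\<lambda>z n. of_bool (gray_digit n z) * (1 / 2) ^ Suc n :: real"
  have head: "depth (c ## z) = ?f (c ## z) 0 + (\<Sum>n. ?f (c ## z) (Suc n))"
    unfolding depth_def using suminf_split_head[OF depth_summable, of "c ## z"] by simp
  show ?thesis
  proof (cases "c \<in> {0, 5}")
    case True
    then have "?f (c ## z) (Suc n) = ?f z n / 2" for n by auto
    then have "(\<Sum>n. ?f (c ## z) (Suc n)) = depth z / 2"
      unfolding depth_def by (simp only: suminf_divide[OF depth_summable])
    then show ?thesis using head True by auto
  next
    case False
    then have "?f (c ## z) (Suc n) = (1 / 2) ^ Suc n / 2 - ?f z n / 2" for n by auto
    then have "(\<Sum>n. ?f (c ## z) (Suc n)) = (\<Sum>n. (1 / 2) ^ Suc n / 2 - ?f z n / 2)"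
      by (simp only:)
    also have "\<dots> = (\<Sum>n. (1 / 2) ^ Suc n / 2) - (\<Sum>n. ?f z n / 2)"
      using sums_summable[OF power_half_series] depth_summable
      by (intro suminf_diff[symmetric] summable_divide)
    also have "\<dots> = 1 / 2 - depth z / 2"
      unfolding depth_def suminf_divide[OF depth_summable]
        suminf_divide[OF sums_summable[OF power_half_series]]
      using sums_unique[OF power_half_series] by simp
    finally show ?thesis using head False by auto
  qed
qed

lemma sset_outer:
  assumes "sset v \<subseteq> A" shows "shd v \<in> A" "sset (stl v) \<subseteq> A"
  using assms by (cases v; simp)+

lemma depth_outer:
  assumes "sset v \<subseteq> {0, 5}" shows "depth v = 0"
proof -
  have "\<not> gray_digit n v" for n
    using assms
  proof (induction n arbitrary: v)
    case 0
    from sset_outer(1)[OF this] show ?case by auto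
  next
    case (Suc n)
    then show ?case using sset_outer[OF Suc.prems] by auto
  qed
  then show ?thesis by (simp add: depth_def)
qed

lemma depth_prefix: "\<bar>depth (w @- s) - depth (w @- t)\<bar> \<le> 1 / 2 ^ length w"
proof (induction w)
  case Nil
  show ?case using depth_range[of s] depth_range[of t] by (simp add: abs_le_iff)
next
  case (Cons a w)
  then show ?case by (auto simp: depth_Cons abs_le_iff field_simps)
qed

text \<open>
  On both sides of an edge between two subcells the depth is 1/2, whether the subcell bounds {0, 5} or
  not.
\<close>

lemma depth_glue:
  assumes "c \<notin> {0, 5}" "sset v \<subseteq> {0, 5}"
  shows "depth (w @- i ## c ## v) = depth (w @- (i + 1) ## c ## v)"
proof (induction w)
  case Nil
  show ?case using assms by (auto simp: depth_Cons depth_outer)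
qed (simp add: depth_Cons)

definition side :: "letter \<Rightarrow> nat" where
  "side c = (if c \<in> {0, 5} then 0 else if c \<in> {1, 2} then 1 else 2)"

text \<open>
  The depth below the side that bounds the subcell c. Within a subcell only its own side {0, 5} is an
  outer edge, so the first letter alone has to be treated specially.
\<close>

definition side_depth :: "letter \<Rightarrow> letter stream \<Rightarrow> real" where
  "side_depth c z = (if side (shd z) = side c then depth (stl z) / 2 else 1 - depth (stl z) / 2)"

lemma side_depth_prefix: "\<bar>side_depth c (w @- s) - side_depth c (w @- t)\<bar> \<le> 1 / 2 ^ length w"
proof (cases w)
  case Nil
  have "0 \<le> side_depth c z \<and> side_depth c z \<le> 1" for z
    using depth_range[of "stl z"] by (simp add: side_depth_def)
  from this[of s] this[of t] show ?thesis using Nil by (simp add: abs_le_iff)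
next
  case (Cons a u)
  then show ?thesis using depth_prefix[of u s t] by (auto simp: side_depth_def abs_le_iff field_simps)
qed

lemma side_depth_glue:
  assumes "c \<notin> {0, 5}" "sset v \<subseteq> {0, 5}"
  shows "side_depth d (w @- i ## c ## v) = side_depth d (w @- (i + 1) ## c ## v)"
proof (cases w)
  case Nil
  then show ?thesis using assms by (simp add: side_depth_def depth_Cons depth_outer)
next
  case (Cons a u)
  then show ?thesis using depth_glue[OF assms] by (simp add: side_depth_def)
qed

section \<open>Edge and corner labels\<close>

text \<open>
  The labels of a triangle of level n. An edge label is a lower bound for the number of triangles
  that a walk from the base point to that edge has to cross, and the corner labels form a function on
  the vertices that changes by at most 1 along each edge.
\<close>

datatype labels = Labels (edge05: int) (edge12: int) (edge34: int)
  (corner01: int) (corner23: int) (corner45: int)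

definition edge :: "labels \<Rightarrow> letter \<Rightarrow> int" where
  "edge S c = (if c \<in> {0, 5} then edge05 S else if c \<in> {1, 2} then edge12 S else edge34 S)"

definition corner :: "labels \<Rightarrow> letter \<Rightarrow> int" where
  "corner S c = (if c \<in> {0, 1} then corner01 S else if c \<in> {2, 3} then corner23 S else corner45 S)"

definition other_on_side :: "letter \<Rightarrow> letter" where
  "other_on_side c = (if c \<in> {0, 5} then 5 - c else if c \<in> {1, 2} then 3 - c else 7 - c)"

definition other_at_corner :: "letter \<Rightarrow> letter" where
  "other_at_corner c = (if c \<in> {0, 1} then 1 - c else if c \<in> {2, 3} then 5 - c else 9 - c)"

text \<open>
  The label of the edge from the barycentre to the midpoint of a side. It must differ by at most 1
  from the labels of both halves of the side and from those of the two adjacent edges that end in the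
  corners. A smaller label on another side calls for the smaller of the labels of the two halves, a
  larger one for the larger; the edge labels of a triangle take at most two values, so no conflict arises.
\<close>

definition midpoint_spoke :: "labels \<Rightarrow> letter \<Rightarrow> int" where
  "midpoint_spoke S c = 2 * edge S c +
    (if edge S c \<le> min (edge05 S) (min (edge12 S) (edge34 S)) then max else min)
      (corner S c) (corner S (other_on_side c))"

text \<open>
  In every subcell the side {0, 5} is half of an outer side, the side {1, 2} is the edge to a corner of
  the parent and the side {3, 4} is the edge to a midpoint. Its corners {0, 1}, {2, 3}, {4, 5} are
  respectively the corner of the parent, the barycentre and the midpoint. The edge
  to a corner gets the mean of the labels of the two half sides that end there. The corner labels double,
  like distances in the subdivided graph; the sum of the minimum and the maximum at the barycentre is
  within 1 of all the doubled corner labels and of all sums of two of them.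

  The corner label that is added to the doubled edge label is the whole point: it raises the label of
  one half of a side over that of the other half, and makes the labels grow faster than 2^n.
\<close>

definition child :: "letter \<Rightarrow> labels \<Rightarrow> labels" where
  "child c S = Labels (2 * edge S c + corner S c)
    (edge S c + edge S (other_at_corner c) + corner S c) (midpoint_spoke S c)
    (2 * corner S c)
    (min (corner01 S) (min (corner23 S) (corner45 S)) + max (corner01 S) (max (corner23 S) (corner45 S)))
    (corner S c + corner S (other_on_side c))"

fun balanced :: "labels \<Rightarrow> bool" where
  "balanced (Labels a b c p q r) \<longleftrightarrow>
    \<bar>a - b\<bar> \<le> 1 \<and> \<bar>b - c\<bar> \<le> 1 \<and> \<bar>c - a\<bar> \<le> 1 \<and> \<bar>p - q\<bar> \<le> 1 \<and> \<bar>q - r\<bar> \<le> 1 \<and> \<bar>r - p\<bar> \<le> 1"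

text \<open>
  One subcell, seen from its side e: it lies at the corner x of e, where the side f ends as well, the
  other end of e is y, and the remaining side and corner are g and z.
\<close>

lemma balanced_subdivision:
  fixes e f g x y z :: int
  assumes "balanced (Labels e f g x y z)"
  shows "balanced (Labels (2 * e + x) (e + f + x)
    (2 * e + (if e \<le> f \<and> e \<le> g then max x y else min x y))
    (2 * x) (min x (min y z) + max x (max y z)) (x + y))"
  using assms by (auto simp: min_def max_def abs_le_iff)

lemma balanced_child:
  assumes "balanced S" shows "balanced (child i S)"
proof (cases S)
  case (Labels a b c p q r)
  note expand = child_def edge_def corner_def other_on_side_def other_at_corner_def midpoint_spoke_def
  have bal: "balanced (Labels a b c p r q)" "balanced (Labels b a c p q r)"
    "balanced (Labels b c a q p r)" "balanced (Labels c b a q r p)"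
    "balanced (Labels c a b r q p)" "balanced (Labels a c b r p q)"
    using assms unfolding Labels by (auto simp: abs_minus_commute)
  show ?thesis
    using bal[THEN balanced_subdivision] unfolding Labels
    by (cases i rule: letter_cases; hypsubst;
      auto simp: expand ac_simps simp del: balanced.simps split: if_splits)
qed

definition agree :: "labels \<Rightarrow> labels \<Rightarrow> letter \<Rightarrow> bool" where
  "agree S T c \<longleftrightarrow> edge S c = edge T c \<and> corner S c = corner T c \<and>
    corner S (other_on_side c) = corner T (other_on_side c)"

lemma agree_child:
  assumes "agree S T c" "d \<in> {0, 5}" shows "agree (child c S) (child c T) d"
proof -
  have "edge05 (child c S) = edge05 (child c T)" "corner01 (child c S) = corner01 (child c T)"
    "corner45 (child c S) = corner45 (child c T)"
    using assms(1) by (simp_all add: agree_def child_def)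
  moreover have "other_on_side 0 = 5" "other_on_side 5 = 0" by (simp_all add: other_on_side_def)
  ultimately show ?thesis using assms(2) by (auto simp: agree_def edge_def corner_def)
qed

text \<open>
  The edge between two consecutive subcells runs from the barycentre to a corner if i is even and to a
  midpoint if i is odd. In both cases its labels are symmetric in the two subcells.
\<close>

lemma agree_siblings:
  assumes "i \<in> {0, 2, 4} \<and> c \<in> {1, 2} \<or> i \<in> {1, 3, 5} \<and> c \<in> {3, 4}"
  shows "agree (child i S) (child (i + 1) S) c"
  using assms
  by (elim disjE conjE insertE emptyE; hypsubst;
    simp add: agree_def child_def edge_def corner_def other_on_side_def other_at_corner_def midpoint_spoke_def
      max.commute min.commute)

section \<open>Potentials\<close>

text \<open>
  Subdivide the labels k times and interpolate between the edge labels of the resulting triangle. On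
  each edge the minimum is attained by the term of that edge, because the labels are balanced.
\<close>

primrec potential :: "nat \<Rightarrow> labels \<Rightarrow> letter stream \<Rightarrow> real" where
  "potential 0 S z = min (edge05 S + side_depth 0 z)
    (min (edge12 S + side_depth 1 z) (edge34 S + side_depth 3 z))"
| "potential (Suc k) S z = potential k (child (shd z) S) (stl z)"

lemma potential_0_side:
  assumes "balanced S" "sset v \<subseteq> {0, 5}"
  shows "potential 0 S (c ## v) = edge S c"
proof (cases S)
  case (Labels a b d p q r)
  have "\<bar>real_of_int a - real_of_int b\<bar> \<le> 1" "\<bar>real_of_int b - real_of_int d\<bar> \<le> 1"
    "\<bar>real_of_int d - real_of_int a\<bar> \<le> 1"
    using assms(1) unfolding Labels by (simp_all; linarith)+
  then show ?thesis using depth_outer[OF assms(2)] unfolding Labels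
    by (cases c rule: letter_cases; hypsubst; simp add: edge_def side_depth_def side_def; linarith)
qed

lemma potential_agree:
  assumes "balanced S" "balanced T" "agree S T c" "sset v \<subseteq> {0, 5}"
  shows "potential k S (c ## v) = potential k T (c ## v)"
  using assms
proof (induction k arbitrary: S T c v)
  case 0
  then show ?case by (simp only: potential_0_side agree_def)
next
  case (Suc k)
  have "shd v \<in> {0, 5}" by (rule sset_outer[OF Suc.prems(4)])
  moreover have "sset (stl v) \<subseteq> {0, 5}" by (rule sset_outer[OF Suc.prems(4)])
  ultimately have "potential k (child c S) (shd v ## stl v) = potential k (child c T) (shd v ## stl v)"
    using Suc.prems by (intro Suc.IH balanced_child agree_child)
  then show ?case by simp
qed

text \<open>
  An identification across an edge that appears within the first k levels is respected because the
  labels on its two sides agree, and a deeper one because the depth functions respect it.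
\<close>

lemma potential_hex_ident:
  assumes "hex_ident x y" "balanced S" shows "potential k S x = potential k S y"
proof -
  obtain w i c v where x: "x = w @- i ## c ## v" and y: "y = w @- (i + 1) ## c ## v"
    and ic: "i \<in> {0, 2, 4} \<and> c \<in> {1, 2} \<or> i \<in> {1, 3, 5} \<and> c \<in> {3, 4}"
    and c: "c \<notin> {0, 5}" and v: "sset v \<subseteq> {0, 5}"
    using assms(1) by (rule hex_ident_cases)
  show ?thesis
    unfolding x y using assms(2)
  proof (induction w arbitrary: k S)
    case Nil
    show ?case
    proof (cases k)
      case 0
      then show ?thesis using side_depth_glue[OF c v, of _ "[]" i] by simp
    next
      case (Suc j)
      have "potential j (child i S) (c ## v) = potential j (child (i + 1) S) (c ## v)"
        using Nil ic v by (intro potential_agree balanced_child agree_siblings)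
      then show ?thesis using Suc by simp
    qed
  next
    case (Cons a w)
    show ?case
    proof (cases k)
      case 0
      then show ?thesis using side_depth_glue[OF c v, of _ "a # w" i] by simp
    next
      case (Suc j)
      then show ?thesis using Cons.IH[OF balanced_child[OF Cons.prems]] by simp
    qed
  qed
qed

lemma potential_prefix:
  assumes "k \<le> length w"
  shows "\<bar>potential k S (w @- s) - potential k S (w @- t)\<bar> \<le> 2 ^ k / 2 ^ length w"
  using assms
proof (induction k arbitrary: S w)
  case 0
  have "\<bar>min a (min b c) - min a' (min b' c')\<bar> \<le> e"
    if "\<bar>a - a'\<bar> \<le> e" "\<bar>b - b'\<bar> \<le> e" "\<bar>c - c'\<bar> \<le> e" for a b c a' b' c' e :: real
    using that by linarith
  then show ?case using side_depth_prefix[of _ w s t] by (simp only: potential.simps) (simp add: algebra_simps)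
next
  case (Suc k)
  then obtain a u where "w = a # u" by (cases w) auto
  then show ?case using Suc by simp
qed

text \<open>
  The corner labels rise by 1 along the edge from the corner {0, 1} to the corner {4, 5}, the two
  corners between which the potential is to grow.
\<close>

definition start :: labels where "start = Labels 0 0 0 0 0 1"

lemma balanced_start: "balanced start" by (simp add: start_def)

lift_definition hex_potential :: "nat \<Rightarrow> hexacarpet \<Rightarrow> real" is "\<lambda>k. potential k start"
  using potential_hex_ident balanced_start by (fastforce simp: hex_sim_def)

text \<open>
  Near the corner {0, 1} one subdivision takes the edge label a and the corner label p to 2 a + p and
  2 p, so relative to the doubling it adds p / 2 to the edge label every time.
\<close>

lemma potential_zeros:
  assumes "balanced S" "corner01 S = p"
  shows "potential k S (sconst 0) = 2 ^ k * (edge05 S + real k * p / 2)"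
  using assms
proof (induction k arbitrary: S p)
  case 0
  have "sconst 0 = (0 ## sconst 0 :: letter stream)" by (subst siterate.ctr) simp
  moreover have "potential 0 S (0 ## sconst 0) = edge05 S"
    using potential_0_side[OF 0(1), of "sconst 0" 0] by (simp add: edge_def del: potential.simps)
  ultimately have "potential 0 S (sconst 0) = edge05 S" by (simp only:)
  then show ?case by (simp only:) simp
next
  case (Suc k)
  have "corner01 (child 0 S) = 2 * p" using Suc.prems by (simp add: child_def corner_def)
  from Suc.IH[OF balanced_child[OF Suc.prems(1)] this] show ?case
    using Suc.prems(2) by (simp add: child_def edge_def corner_def field_simps)
qed

lemma hex_potential_gap:
  "hex_potential k (hex_proj (5 ## sconst 0)) - hex_potential k (hex_proj (sconst 0)) = 2 ^ k * real k / 2"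
proof -
  have "potential k start (sconst 0) = 0"
    using potential_zeros[OF balanced_start refl, of k] by (simp add: start_def)
  moreover have "potential k start (5 ## sconst 0) = 2 ^ k * real k / 2"
  proof (cases k)
    case 0
    then show ?thesis using potential_0_side[OF balanced_start, of "sconst 0" 5] by (simp add: edge_def start_def)
  next
    case (Suc j)
    have "corner01 (child 5 start) = 2" "edge05 (child 5 start) = 1"
      by (simp_all add: child_def corner_def edge_def start_def)
    then show ?thesis using potential_zeros[OF balanced_child[OF balanced_start], of 5 2 j] Suc
      by (simp add: algebra_simps)
  qed
  ultimately show ?thesis by (simp add: hex_potential.abs_eq)
qed

lemma hex_potential_cell:
  assumes "x \<in> hex_cell w" "y \<in> hex_cell w" "k \<le> length w"
  shows "\<bar>hex_potential k x - hex_potential k y\<bar> \<le> 2 ^ k * (1 / 2) ^ length w"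
  using assms(1,2) potential_prefix[OF assms(3), of start]
  by (auto simp: hex_cell_iff hex_potential.abs_eq power_divide)

text \<open>
  The potential is Lipschitz for the distance with \<mu> = 1/2 as long as only cells of level at least
  k are used.
\<close>

lemma hex_potential_chain:
  assumes "ws \<in> hex_chains x y" "\<And>w. w \<in> set ws \<Longrightarrow> k \<le> length w"
  shows "\<bar>hex_potential k x - hex_potential k y\<bar> \<le> 2 ^ k * (\<Sum>w\<leftarrow>ws. (1 / 2) ^ length w)"
  using assms
proof (induction ws arbitrary: x)
  case Nil
  then show ?case by (simp add: hex_chains_def hex_chain_def)
next
  case (Cons w ws)
  have x: "x \<in> hex_cell w" and k: "k \<le> length w"
    using Cons.prems by (simp_all add: hex_chains_def)
  show ?case
  proof (cases "ws = []")
    case True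
    then have "y \<in> hex_cell w" using Cons.prems by (simp add: hex_chains_def)
    then show ?thesis using hex_potential_cell[OF x _ k] True by simp
  next
    case False
    then obtain p where p: "p \<in> hex_cell w" "ws \<in> hex_chains p y"
      using Cons.prems(1) by (auto simp: hex_chains_def hex_chain_def successively_Cons)
    have "\<bar>hex_potential k p - hex_potential k y\<bar> \<le> 2 ^ k * (\<Sum>w\<leftarrow>ws. (1 / 2) ^ length w)"
      using Cons.prems(2) by (intro Cons.IH p(2)) simp
    then show ?thesis using hex_potential_cell[OF x p(1) k]
      by (simp add: distrib_left abs_le_iff)
  qed
qed

section \<open>Failure of the chain condition\<close>

text \<open>
  Taking n steps, with n large in terms of k, forces every cell in the connecting chains to have
  level at least k, while the total weight remains bounded by 2 C. The potential between the two
  ends of an edge then gives k \<le> 4 C for every k.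
\<close>

lemma not_chain_condition_hex_dist:
  assumes "1 / 2 \<le> \<mu>" "\<mu> < 1"
  shows "\<not> chain_condition (UNIV :: hexacarpet set) (hex_dist \<mu>)"
proof
  assume "chain_condition (UNIV :: hexacarpet set) (hex_dist \<mu>)"
  then obtain C where C: "0 < C"
    "\<And>x y n. n \<ge> 1 \<Longrightarrow> \<exists>z :: nat \<Rightarrow> hexacarpet. z 0 = x \<and> z n = y \<and>
      (\<forall>i<n. hex_dist \<mu> (z i) (z (i + 1)) \<le> C * (hex_dist \<mu> x y / real n))"
    unfolding chain_condition_def by (metis UNIV_I)
  have \<mu>: "0 < \<mu>" using assms by simp
  obtain k :: nat where k: "4 * C < real k" using reals_Archimedean2 by blast
  obtain n :: nat where n: "2 * C / \<mu> ^ k < real n" using reals_Archimedean2 by blast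
  have "0 < 2 * C / \<mu> ^ k" using C(1) \<mu> by simp
  with n have n1: "0 < real n" by linarith
  have small: "2 * C / real n < \<mu> ^ k" using n n1 \<mu> by (simp add: field_simps)
  define x y where "x = hex_proj (sconst 0)" and "y = hex_proj (5 ## sconst 0)"
  obtain z where z: "z 0 = x" "z n = y"
    "\<And>i. i < n \<Longrightarrow> hex_dist \<mu> (z i) (z (i + 1)) \<le> C * (hex_dist \<mu> x y / real n)"
    using C(2)[of n x y] n1 by auto
  have "hex_dist \<mu> x y \<le> 1"
    using hex_dist_cell[OF \<mu>, of x "[]" y] by (simp add: hex_cell_Nil)
  then have "C * (hex_dist \<mu> x y / real n) \<le> C * (1 / real n)"
    using C(1) n1 by (intro mult_left_mono divide_right_mono) auto
  moreover have "C * (1 / real n) < 2 * C / real n" using C(1) n1 by (simp add: field_simps)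
  ultimately have short: "hex_dist \<mu> (z i) (z (i + 1)) < 2 * C / real n" if "i < n" for i
    using z(3)[OF that] by linarith
  have step: "\<bar>hex_potential k (z (Suc i)) - hex_potential k (z i)\<bar> \<le> 2 ^ k * (2 * C / real n)"
    if i: "i < n" for i
  proof -
    obtain ws where ws: "ws \<in> hex_chains (z i) (z (i + 1))"
      "(\<Sum>w\<leftarrow>ws. hex_weight \<mu> w) < 2 * C / real n"
      using hex_dist_less_chain[OF \<mu> short[OF i]] by blast
    have "k \<le> length w" if "w \<in> set ws" for w
    proof (rule ccontr)
      assume "\<not> k \<le> length w"
      then have "\<mu> ^ k \<le> \<mu> ^ length w" using assms \<mu> by (intro power_decreasing) auto
      moreover have "hex_weight \<mu> w \<le> (\<Sum>w\<leftarrow>ws. hex_weight \<mu> w)"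
        using that \<mu> by (intro member_le_sum_list) (auto simp: hex_weight_def)
      ultimately show False using ws(2) small by (simp add: hex_weight_def)
    qed
    from hex_potential_chain[OF ws(1) this]
    have "\<bar>hex_potential k (z i) - hex_potential k (z (i + 1))\<bar>
        \<le> 2 ^ k * (\<Sum>w\<leftarrow>ws. (1 / 2) ^ length w)" .
    moreover have "(\<Sum>w\<leftarrow>ws. (1 / 2) ^ length w) \<le> (\<Sum>w\<leftarrow>ws. hex_weight \<mu> w)"
      using assms(1) by (intro sum_list_mono) (simp add: hex_weight_def power_mono)
    then have "2 ^ k * (\<Sum>w\<leftarrow>ws. (1 / 2 :: real) ^ length w) \<le> 2 ^ k * (2 * C / real n)"
      using ws(2) by (intro mult_left_mono) auto
    ultimately show ?thesis by (simp add: abs_minus_commute)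
  qed
  have "hex_potential k (z n) - hex_potential k (z 0) =
      (\<Sum>i<n. hex_potential k (z (Suc i)) - hex_potential k (z i))"
    by (rule sum_lessThan_telescope[symmetric])
  also have "\<dots> \<le> (\<Sum>i<n. 2 ^ k * (2 * C / real n))"
    using step by (intro sum_mono) (simp add: abs_le_iff)
  also have "\<dots> = 2 ^ k * (2 * C)" using n1 by simp
  finally have "2 ^ k * real k / 2 \<le> 2 ^ k * (2 * C)"
    using hex_potential_gap[of k] z(1,2) by (simp add: x_def y_def)
  then have "real k \<le> 4 * C" by simp
  with k show False by simp
qed

theorem proposition2p3:
  fixes \<mu> :: real
  assumes "1/2 \<le> \<mu>" and "\<mu> < 1"
  shows "\<not> chain_condition (UNIV :: hexacarpet set) (hex_dist \<mu>) \<and>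
    (\<forall>\<theta>. 0 < \<theta> \<and> \<theta> < - ln \<mu> / ln 2 \<longrightarrow>
      theta_chain_condition \<theta> (UNIV :: hexacarpet set) (hex_dist \<mu>))"
  using not_chain_condition_hex_dist theta_chain_condition_hex_dist assms by blast

end
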